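(* Let $z_{k-1}\ne z_k$ in $\mathbb{R}^{n+1}$, $s_{k-1}=z_k-z_{k-1}$, let $b_k\in\mathbb{R}^{n+1}$ be nonzero, $\vartheta>1$, $\mu_k\ge0$, $g_k=\nabla\Phi_\tau(z_k)$, and let $d_k$ and $\widetilde b_k$ be the enhanced three-term direction and the regularized curvature response defined in the context. Then $$d_k^T\widetilde b_k=-\theta_k\,g_k^Ts_{k-1},$$ where $$\theta_k=\frac{\widetilde b_k^TP_k^{-1}\widetilde b_k}{s_{k-1}^T\widetilde b_k}+\mu_k\frac{s_{k-1}^T\widetilde b_k}{s_{k-1}^TP_ks_{k-1}}>0.$$
   Context: Let $f_1,\dots,f_m\in C^1(\mathbb{R}^n)$ have gradients that are Lipschitz on $\mathbb{R}^n$ with constants $L_i\ge0$; $\bar L=\sum_i L_i$; $\tau>0$, $\delta>0$. Let $\phi_\tau(r)=\frac{r+\sqrt{r^2+\tau^2}}{2}$ and $\Phi_\tau(x,t)=t+\sum_{i=1}^m\phi_\tau(f_i(x)-t)$ on $\mathbb{R}^{n+1}$. At $z_k=(x_k,t_k)$ let $\omega_{i,k}=\sqrt{(f_i(x_k)-t_k)^2+\tau^2}$, $J_k$ the $m\times(n+1)$ matrix with rows $(\nabla f_i(x_k)^T,-1)$, $D_k=\operatorname{diag}(\omega_{1,k}^{-1},\dots,\omega_{m,k}^{-1})$, $\Pi_x=\operatorname{diag}(I_n,0)$, and $P_k=\delta I_{n+1}+\bar L\Pi_x+\frac12J_k^TD_kJ_k$, a symmetric positive definite matrix. Put $C_k=s_{k-1}^TP_ks_{k-1}$,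 $B_k=b_k^TP_k^{-1}b_k$, $\Delta_k=s_{k-1}^Tb_k$, $\mathcal{D}_k=\Delta_k+\vartheta\sqrt{C_kB_k}$ (which is positive). The enhanced direction is $$d_k=-P_k^{-1}g_k+\left[\frac{g_k^TP_k^{-1}b_k}{\mathcal{D}_k}-\mu_k\frac{g_k^Ts_{k-1}}{C_k}\right]s_{k-1}-\frac{g_k^Ts_{k-1}}{\mathcal{D}_k}P_k^{-1}b_k.$$ The regularized curvature response is $\widetilde b_k=b_k+\vartheta\sqrt{B_k/C_k}\,P_ks_{k-1}$; it satisfies $s_{k-1}^T\widetilde b_k=\mathcal{D}_k$. *)

theory Defs
  imports "HOL-Analysis.Analysis"
begin

definition gradient :: "('a::real_inner \<Rightarrow> real) \<Rightarrow> 'a \<Rightarrow> 'a" where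
  "gradient F x = (THE D. GDERIV F x :> D)"

lemma gradient_eqI:
  assumes "GDERIV F x :> D"
  shows "gradient F x = D"
  unfolding gradient_def
proof (rule the_equality)
  fix D' assume "GDERIV F x :> D'"
  with assms have "(\<lambda>h. inner h D') = (\<lambda>h. inner h D)"
    unfolding gderiv_def by (rule has_derivative_unique[rotated])
  then have "inner h (D' - D) = 0" for h
    by (metis inner_diff_right eq_iff_diff_eq_0)
  then show "D' = D"
    by (metis inner_eq_zero_iff eq_iff_diff_eq_0)
qed (rule assms)

lemma GDERIV_gradient:
  fixes F :: "'a::euclidean_space \<Rightarrow> real"
  assumes "F differentiable (at x)"
  shows "GDERIV F x :> gradient F x"
proof -
  from assms obtain F' where F': "(F has_derivative F') (at x)"
    unfolding differentiable_def by blast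
  interpret bounded_linear F' using F' by (rule has_derivative_bounded_linear)
  define D where "D = (\<Sum>b\<in>Basis. F' b *\<^sub>R b)"
  have "F' = (\<lambda>h. inner h D)"
  proof
    fix h
    have "F' h = F' (\<Sum>b\<in>Basis. (inner h b) *\<^sub>R b)" by (simp add: euclidean_representation)
    also have "\<dots> = inner h D" by (simp add: D_def sum scaleR inner_sum_right mult.commute)
    finally show "F' h = inner h D" .
  qed
  then have "GDERIV F x :> D"
    using F' by (simp add: gderiv_def)
  then show ?thesis using gradient_eqI by metis
qed

text \<open>
  The space of pairs \<open>z = (x, t)\<close>, i.e. Euclidean space of dimension \<open>n + 1\<close>, is
  \<open>real ^ 'n option\<close>: the components at \<open>Some j\<close> form \<open>x\<close>, the component at \<open>None\<close> is \<open>t\<close>.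
\<close>

definition xpart :: "real ^ 'n option \<Rightarrow> real ^ 'n::finite" where
  "xpart z = (\<chi> j. z $ Some j)"

definition tpart :: "real ^ 'n::finite option \<Rightarrow> real" where
  "tpart z = z $ None"

definition smooth_pos :: "real \<Rightarrow> real \<Rightarrow> real" where
  "smooth_pos \<tau> r = (r + sqrt (r\<^sup>2 + \<tau>\<^sup>2)) / 2"

definition Phi :: "real \<Rightarrow> ('m::finite \<Rightarrow> real ^ 'n::finite \<Rightarrow> real) \<Rightarrow> real ^ 'n option \<Rightarrow> real" where
  "Phi \<tau> f z = tpart z + (\<Sum>i\<in>UNIV. smooth_pos \<tau> (f i (xpart z) - tpart z))"

definition omega :: "real \<Rightarrow> ('m::finite \<Rightarrow> real ^ 'n::finite \<Rightarrow> real) \<Rightarrow> real ^ 'n option \<Rightarrow> 'm \<Rightarrow> real" where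
  "omega \<tau> f z i = sqrt ((f i (xpart z) - tpart z)\<^sup>2 + \<tau>\<^sup>2)"

definition diag_mat :: "('k::finite \<Rightarrow> real) \<Rightarrow> real ^ 'k ^ 'k" where
  "diag_mat v = (\<chi> i j. if i = j then v i else 0)"

definition Jmat :: "('m::finite \<Rightarrow> real ^ 'n::finite \<Rightarrow> real) \<Rightarrow> real ^ 'n option \<Rightarrow> real ^ 'n option ^ 'm" where
  "Jmat f z = (\<chi> i j. case j of Some l \<Rightarrow> gradient (f i) (xpart z) $ l | None \<Rightarrow> - 1)"

definition Dmat :: "real \<Rightarrow> ('m::finite \<Rightarrow> real ^ 'n::finite \<Rightarrow> real) \<Rightarrow> real ^ 'n option \<Rightarrow> real ^ 'm ^ 'm" where
  "Dmat \<tau> f z = diag_mat (\<lambda>i. inverse (omega \<tau> f z i))"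

definition Pi_x :: "real ^ 'n::finite option ^ 'n option" where
  "Pi_x = diag_mat (\<lambda>j. case j of Some _ \<Rightarrow> 1 | None \<Rightarrow> 0)"

definition Pmat ::
  "real \<Rightarrow> real \<Rightarrow> ('m::finite \<Rightarrow> real) \<Rightarrow> ('m \<Rightarrow> real ^ 'n::finite \<Rightarrow> real) \<Rightarrow> real ^ 'n option
     \<Rightarrow> real ^ 'n option ^ 'n option" where
  "Pmat \<delta> \<tau> L f z =
     \<delta> *\<^sub>R mat 1 + (\<Sum>i\<in>UNIV. L i) *\<^sub>R Pi_x
     + (1/2) *\<^sub>R (transpose (Jmat f z) ** Dmat \<tau> f z ** Jmat f z)"

text \<open>
  In the following, \<open>s\<close> is the step between consecutive iterates, \<open>b\<close> the raw curvature
  response and \<open>g\<close> the gradient; \<open>matrix_inv P\<close> is meaningful for invertible \<open>P\<close> only.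
\<close>

definition Cval :: "real ^ 'k ^ 'k \<Rightarrow> real ^ 'k \<Rightarrow> real" where
  "Cval P s = s \<bullet> (P *v s)"

definition Bval :: "real ^ 'k ^ 'k \<Rightarrow> real ^ 'k \<Rightarrow> real" where
  "Bval P b = b \<bullet> (matrix_inv P *v b)"

definition Dval :: "real \<Rightarrow> real ^ 'k ^ 'k \<Rightarrow> real ^ 'k \<Rightarrow> real ^ 'k \<Rightarrow> real" where
  "Dval vartheta P s b = s \<bullet> b + vartheta * sqrt (Cval P s * Bval P b)"

definition enhanced_dir ::
  "real \<Rightarrow> real \<Rightarrow> real ^ 'k ^ 'k \<Rightarrow> real ^ 'k \<Rightarrow> real ^ 'k \<Rightarrow> real ^ 'k \<Rightarrow> real ^ 'k" where
  "enhanced_dir vartheta \<mu> P s b g =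
     - (matrix_inv P *v g)
     + (g \<bullet> (matrix_inv P *v b) / Dval vartheta P s b - \<mu> * (g \<bullet> s / Cval P s)) *\<^sub>R s
     - (g \<bullet> s / Dval vartheta P s b) *\<^sub>R (matrix_inv P *v b)"

definition reg_response :: "real \<Rightarrow> real ^ 'k ^ 'k \<Rightarrow> real ^ 'k \<Rightarrow> real ^ 'k \<Rightarrow> real ^ 'k" where
  "reg_response vartheta P s b = b + (vartheta * sqrt (Bval P b / Cval P s)) *\<^sub>R (P *v s)"

end

theory Submission
  imports Defs
begin

text \<open>
  Everything rests on \<open>P\<close> being symmetric positive definite (\<open>sym_pos_def_Pmat\<close>); the
  identity is then algebra in \<open>s\<close>, \<open>b\<close> and \<open>g\<close> (\<open>enhanced_dir_inner_reg_response\<close>). Write \<open>Q = P\<^sup>-\<^sup>1\<close>, \<open>\<kappa> = \<vartheta> \<surd>(B/C)\<close> and \<open>D\<close> for the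
  denominator, so that the regularized response is \<open>bt = b + \<kappa> P s\<close>. Then \<open>s \<bullet> bt = D\<close>, and for
  every \<open>v\<close> one has \<open>v \<bullet> Q bt = v \<bullet> Q b + \<kappa> (v \<bullet> s)\<close>. Pairing the direction with \<open>bt\<close>, the
  coefficient \<open>(g \<bullet> Q b)/D\<close> of \<open>s\<close> contributes exactly \<open>g \<bullet> Q b\<close>, which cancels the part of
  \<open>- g \<bullet> Q bt\<close> that is not a multiple of \<open>g \<bullet> s\<close>. What is left is \<open>- (g \<bullet> s)\<close> times
  \<open>\<kappa> + (b \<bullet> Q bt)/D + \<mu> D/C\<close>, and the formula with \<open>v = bt\<close> turns the first two summands into
  \<open>(bt \<bullet> Q bt)/D\<close>.

  For the sign, the Cauchy-Schwarz inequality \<open>(s \<bullet> b)\<^sup>2 \<le> C B\<close> in the inner product of \<open>P\<close>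
  together with \<open>\<vartheta> > 1\<close> gives \<open>D > 0\<close> (\<open>Dval_pos\<close>). Hence \<open>bt \<noteq> 0\<close>, and \<open>bt \<bullet> Q bt > 0\<close>
  because \<open>Q\<close> is positive definite as well.
\<close>

text \<open>
  Symmetry is phrased as self-adjointness because this form passes to sums and
  inverses by evaluating both sides on vectors.
\<close>

definition sym_pos_def :: "real ^ 'k ^ 'k \<Rightarrow> bool" where
  "sym_pos_def A \<longleftrightarrow> (\<forall>x y. x \<bullet> (A *v y) = (A *v x) \<bullet> y) \<and> (\<forall>x. x \<noteq> 0 \<longrightarrow> 0 < x \<bullet> (A *v x))"

lemma sym_pos_def_sym: "sym_pos_def A \<Longrightarrow> x \<bullet> (A *v y) = (A *v x) \<bullet> y"
  by (simp add: sym_pos_def_def)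

lemma sym_pos_def_pos: "sym_pos_def A \<Longrightarrow> x \<noteq> 0 \<Longrightarrow> 0 < x \<bullet> (A *v x)"
  unfolding sym_pos_def_def by blast

lemma sym_pos_def_nonneg: "sym_pos_def A \<Longrightarrow> 0 \<le> x \<bullet> (A *v x)"
  by (cases "x = 0") (auto dest: sym_pos_def_pos)

text \<open>A vector in the kernel would have vanishing quadratic form.\<close>

lemma sym_pos_def_invertible:
  assumes "sym_pos_def A"
  shows "invertible A"
proof -
  have "x = 0" if "A *v x = 0" for x
    using that sym_pos_def_pos[OF assms, of x] by auto
  then show ?thesis
    by (simp add: invertible_left_inverse matrix_left_invertible_ker)
qed

lemma sym_pos_def_mult_inv:
  fixes A :: "real ^ 'k ^ 'k"
  assumes "sym_pos_def A"
  shows "A *v (matrix_inv A *v x) = x" and "matrix_inv A *v (A *v x) = x"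
proof -
  have "A ** matrix_inv A = mat 1 \<and> matrix_inv A ** A = mat 1"
    using sym_pos_def_invertible[OF assms] unfolding invertible_def matrix_inv_def by (rule someI_ex)
  then show "A *v (matrix_inv A *v x) = x" and "matrix_inv A *v (A *v x) = x"
    by (simp_all add: matrix_vector_mul_assoc)
qed

text \<open>
  The quadratic form of the inverse at \<open>x\<close> is that of the matrix at the preimage of \<open>x\<close>.
\<close>

lemma sym_pos_def_inv:
  assumes "sym_pos_def A"
  shows "sym_pos_def (matrix_inv A)"
  unfolding sym_pos_def_def
proof (intro conjI allI impI)
  fix x y
  show "x \<bullet> (matrix_inv A *v y) = (matrix_inv A *v x) \<bullet> y"
    using sym_pos_def_sym[OF assms, of "matrix_inv A *v x" "matrix_inv A *v y"]
    by (simp add: sym_pos_def_mult_inv[OF assms])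
next
  fix x :: "real ^ 'a"
  assume "x \<noteq> 0"
  then have "matrix_inv A *v x \<noteq> 0"
    using sym_pos_def_mult_inv(1)[OF assms, of x] by auto
  then show "0 < x \<bullet> (matrix_inv A *v x)"
    using sym_pos_def_pos[OF assms, of "matrix_inv A *v x"]
    by (simp add: sym_pos_def_mult_inv[OF assms] inner_commute)
qed

text \<open>
  This is the Cauchy-Schwarz inequality for the inner product \<open>(x, y) \<mapsto> x \<bullet> A y\<close>, applied to
  \<open>s\<close> and \<open>A\<^sup>-\<^sup>1 b\<close>.
\<close>

lemma sym_pos_def_Cauchy_Schwarz:
  assumes A: "sym_pos_def A"
  shows "(s \<bullet> b)\<^sup>2 \<le> Cval A s * Bval A b"
proof (cases "b = 0")
  case True
  then show ?thesis by (simp add: Bval_def)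
next
  case False
  let ?y = "matrix_inv A *v b"
  have B: "0 < Bval A b"
    using sym_pos_def_pos[OF sym_pos_def_inv[OF A] False] by (simp add: Bval_def)
  \<comment> \<open>The multiple of \<open>A\<^sup>-\<^sup>1 b\<close> nearest to \<open>s\<close> in the norm of \<open>A\<close>.\<close>
  define a where "a = (s \<bullet> b) / Bval A b"
  have "?y \<bullet> (A *v s) = s \<bullet> b"
    using sym_pos_def_sym[OF A, of ?y s] by (simp add: sym_pos_def_mult_inv[OF A] inner_commute)
  then have "(s - a *\<^sub>R ?y) \<bullet> (A *v (s - a *\<^sub>R ?y)) = Cval A s - 2 * a * (s \<bullet> b) + a\<^sup>2 * Bval A b"
    by (simp add: Cval_def Bval_def matrix_vector_mult_diff_distrib matrix_vector_mult_scaleR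
        sym_pos_def_mult_inv[OF A] inner_diff_left inner_diff_right inner_commute
        power2_eq_square algebra_simps)
  also have "\<dots> = Cval A s - (s \<bullet> b)\<^sup>2 / Bval A b"
    using B by (simp add: a_def field_simps power2_eq_square)
  finally have "0 \<le> Cval A s - (s \<bullet> b)\<^sup>2 / Bval A b"
    using sym_pos_def_nonneg[OF A, of "s - a *\<^sub>R ?y"] by simp
  then show ?thesis
    using B by (simp add: field_simps)
qed

text \<open>
  The regularizing term dominates \<open>s \<bullet> b\<close> whatever its sign: Cauchy-Schwarz bounds
  \<open>\<bar>s \<bullet> b\<bar>\<close> by \<open>\<surd>(C B)\<close>, and \<open>\<vartheta> > 1\<close> makes the comparison strict.
\<close>

lemma Dval_pos:
  assumes A: "sym_pos_def A" and "s \<noteq> 0" "b \<noteq> 0" "vartheta > 1"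
  shows "0 < Dval vartheta A s b"
proof -
  let ?r = "sqrt (Cval A s * Bval A b)"
  have "0 < Cval A s * Bval A b"
    using assms by (simp add: Cval_def Bval_def sym_pos_def_pos sym_pos_def_inv)
  then have "?r < vartheta * ?r"
    using \<open>vartheta > 1\<close> by simp
  moreover have "\<bar>s \<bullet> b\<bar> \<le> ?r"
    using sym_pos_def_Cauchy_Schwarz[OF A, of s b] real_sqrt_le_mono by fastforce
  ultimately show ?thesis
    by (simp add: Dval_def)
qed

lemma inner_reg_response:
  assumes A: "sym_pos_def A" and "s \<noteq> 0"
  shows "s \<bullet> reg_response vartheta A s b = Dval vartheta A s b"
proof -
  have C: "0 < Cval A s"
    using assms by (simp add: Cval_def sym_pos_def_pos)
  have "sqrt (Bval A b / Cval A s) * Cval A s = sqrt (Cval A s * Bval A b)"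
    using C by (simp add: real_sqrt_divide real_sqrt_mult field_simps)
  then show ?thesis
    by (simp add: reg_response_def Dval_def Cval_def inner_add_right mult.assoc)
qed

text \<open>
  The correction to \<open>b\<close> lies along \<open>P s\<close>, which the inverse maps back to a multiple of \<open>s\<close>;
  this is why pairing with the regularized response produces multiples of \<open>g \<bullet> s\<close>.
\<close>

lemma inner_inv_reg_response:
  assumes A: "sym_pos_def A"
  shows "v \<bullet> (matrix_inv A *v reg_response vartheta A s b)
    = v \<bullet> (matrix_inv A *v b) + vartheta * sqrt (Bval A b / Cval A s) * (v \<bullet> s)"
  by (simp add: reg_response_def matrix_vector_right_distrib matrix_vector_mult_scaleR
      sym_pos_def_mult_inv[OF A] inner_add_right)

text \<open>
  The two terms with denominator \<open>D\<close> are antisymmetric in \<open>s\<close> and \<open>P\<^sup>-\<^sup>1 b\<close>: against \<open>bt\<close>, the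
  first cancels \<open>g \<bullet> P\<^sup>-\<^sup>1 b\<close> coming from the Newton-like part \<open>- P\<^sup>-\<^sup>1 g\<close>, and the second
  completes \<open>\<kappa>\<close> to the quotient \<open>(bt \<bullet> P\<^sup>-\<^sup>1 bt) / D\<close>.
\<close>

lemma enhanced_dir_inner_reg_response:
  fixes A :: "real ^ 'k ^ 'k"
  assumes A: "sym_pos_def A" and s: "s \<noteq> 0" and "b \<noteq> 0" "vartheta > 1"
  defines "bt \<equiv> reg_response vartheta A s b"
  shows "enhanced_dir vartheta \<mu> A s b g \<bullet> bt
    = - (bt \<bullet> (matrix_inv A *v bt) / (s \<bullet> bt) + \<mu> * ((s \<bullet> bt) / Cval A s)) * (g \<bullet> s)"
proof -
  define Q where "Q = matrix_inv A"
  define D where "D = Dval vartheta A s b"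
  define \<kappa> where "\<kappa> = vartheta * sqrt (Bval A b / Cval A s)"
  have D: "D > 0"
    using assms by (simp add: D_def Dval_pos)
  have sbt: "s \<bullet> bt = D"
    using A s by (simp add: bt_def D_def inner_reg_response)
  have Qbt: "v \<bullet> (Q *v bt) = v \<bullet> (Q *v b) + \<kappa> * (v \<bullet> s)" for v
    using inner_inv_reg_response[OF A] by (simp add: Q_def bt_def \<kappa>_def)
  have Q_sym: "(Q *v v) \<bullet> bt = v \<bullet> (Q *v bt)" for v
    using sym_pos_def_sym[OF sym_pos_def_inv[OF A]] by (simp add: Q_def)
  have "enhanced_dir vartheta \<mu> A s b g \<bullet> bt
      = - (g \<bullet> (Q *v bt)) + (g \<bullet> (Q *v b) / D - \<mu> * (g \<bullet> s / Cval A s)) * D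
        - (g \<bullet> s / D) * (b \<bullet> (Q *v bt))"
    by (simp add: enhanced_dir_def Q_def[symmetric] D_def[symmetric] inner_diff_left
        inner_add_left Q_sym sbt)
  also have "\<dots> = - (\<kappa> + b \<bullet> (Q *v bt) / D + \<mu> * (D / Cval A s)) * (g \<bullet> s)"
    using D by (simp add: Qbt[of g] algebra_simps)
  also have "\<kappa> + b \<bullet> (Q *v bt) / D = bt \<bullet> (Q *v bt) / D"
  proof -
    have "bt \<bullet> (Q *v bt) = b \<bullet> (Q *v bt) + \<kappa> * D"
      using Qbt[of bt] Q_sym[of b] sbt by (simp add: inner_commute)
    then show ?thesis
      using D by (simp add: field_simps)
  qed
  finally show ?thesis
    by (simp add: sbt Q_def)
qed

lemma diag_mat_mult_vector: "diag_mat v *v x = (\<chi> i. v i * x $ i)"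
  by (simp add: diag_mat_def matrix_vector_mult_def vec_eq_iff if_distrib[of "\<lambda>c. c * _"]
      sum.delta cong: if_cong)

lemma diag_mat_self_adjoint: "x \<bullet> (diag_mat v *v y) = (diag_mat v *v x) \<bullet> y"
  by (simp add: diag_mat_mult_vector inner_vec_def mult.left_commute mult.assoc)

lemma diag_mat_quadratic_nonneg:
  assumes "\<And>i. 0 \<le> v i"
  shows "0 \<le> x \<bullet> (diag_mat v *v x)"
  unfolding diag_mat_mult_vector inner_vec_def
  by (intro sum_nonneg) (simp add: assms mult.left_commute)

text \<open>
  The term \<open>\<delta> I\<close> is positive definite; the other two are positive semidefinite: \<open>Pi_x\<close> is
  a nonnegative diagonal matrix with a nonnegative factor, and the last is \<open>J\<^sup>T D J\<close> with \<open>D\<close>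
  nonnegative diagonal, so that its quadratic form at \<open>x\<close> is that of \<open>D\<close> at \<open>J x\<close>.
\<close>

lemma sym_pos_def_Pmat:
  fixes f :: "'m::finite \<Rightarrow> real ^ 'n::finite \<Rightarrow> real"
  assumes "\<And>i. 0 \<le> L i" and "\<delta> > 0"
  shows "sym_pos_def (Pmat \<delta> \<tau> L f z)"
proof -
  let ?J = "Jmat f z" and ?D = "Dmat \<tau> f z"
  have apply_P: "x \<bullet> (Pmat \<delta> \<tau> L f z *v y) = \<delta> * (x \<bullet> y) + (\<Sum>i\<in>UNIV. L i) * (x \<bullet> (Pi_x *v y))
      + (1/2) * ((?J *v x) \<bullet> (?D *v (?J *v y)))" for x y
  proof -
    have "x \<bullet> ((transpose ?J ** ?D ** ?J) *v y) = (?J *v x) \<bullet> (?D *v (?J *v y))"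
      by (metis dot_lmul_matrix matrix_vector_mul_assoc vector_transpose_matrix)
    then show ?thesis
      by (simp add: Pmat_def matrix_vector_mult_add_rdistrib scaleR_matrix_vector_assoc[symmetric]
          inner_add_right)
  qed
  have sym: "x \<bullet> (Pmat \<delta> \<tau> L f z *v y) = (Pmat \<delta> \<tau> L f z *v x) \<bullet> y" for x y
  proof -
    have "x \<bullet> (Pi_x *v y) = y \<bullet> (Pi_x *v x)"
      using diag_mat_self_adjoint[of x _ y] by (simp add: Pi_x_def inner_commute)
    moreover have "(?J *v x) \<bullet> (?D *v (?J *v y)) = (?J *v y) \<bullet> (?D *v (?J *v x))"
      using diag_mat_self_adjoint[of "?J *v x" _ "?J *v y"] by (simp add: Dmat_def inner_commute)
    ultimately show ?thesis
      using apply_P[of x y] apply_P[of y x] by (simp add: inner_commute)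
  qed
  have pos: "0 < x \<bullet> (Pmat \<delta> \<tau> L f z *v x)" if "x \<noteq> 0" for x
  proof -
    have "0 < \<delta> * (x \<bullet> x)"
      using that \<open>\<delta> > 0\<close> by simp
    moreover have "0 \<le> (\<Sum>i\<in>UNIV. L i) * (x \<bullet> (Pi_x *v x))"
      unfolding Pi_x_def using assms(1)
      by (intro mult_nonneg_nonneg sum_nonneg diag_mat_quadratic_nonneg) (auto split: option.split)
    moreover have "0 \<le> (?J *v x) \<bullet> (?D *v (?J *v x))"
      unfolding Dmat_def by (intro diag_mat_quadratic_nonneg) (simp add: omega_def)
    ultimately show ?thesis
      by (simp add: apply_P)
  qed
  show ?thesis
    using sym pos by (simp add: sym_pos_def_def)
qed

theorem theorem4p4:
  fixes f :: "'m::finite \<Rightarrow> real ^ 'n::finite \<Rightarrow> real"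
    and L :: "'m \<Rightarrow> real"
    and \<tau> \<delta> vartheta \<mu> :: real
    and z_prev z b s g d bt :: "real ^ 'n option"
    and P :: "real ^ 'n option ^ 'n option"
    and \<theta> :: real
  assumes "\<And>i x. f i differentiable (at x)"
    and "\<And>i. continuous_on UNIV (gradient (f i))"
    and "\<And>i. (L i)-lipschitz_on UNIV (gradient (f i))"
    and "\<tau> > 0" and "\<delta> > 0"
    and "z_prev \<noteq> z" and "b \<noteq> 0" and "vartheta > 1" and "\<mu> \<ge> 0"
    and "s = z - z_prev"
    and "g = gradient (Phi \<tau> f) z"
    and "P = Pmat \<delta> \<tau> L f z"
    and "d = enhanced_dir vartheta \<mu> P s b g"
    and "bt = reg_response vartheta P s b"
    and "\<theta> = bt \<bullet> (matrix_inv P *v bt) / (s \<bullet> bt) + \<mu> * ((s \<bullet> bt) / (s \<bullet> (P *v s)))"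
  shows "d \<bullet> bt = - \<theta> * (g \<bullet> s) \<and> \<theta> > 0"
proof -
  have "0 \<le> L i" for i
    using assms(3) by (rule lipschitz_on_nonneg)
  then have P: "sym_pos_def P"
    using assms(5,12) by (simp add: sym_pos_def_Pmat)
  have s: "s \<noteq> 0"
    using assms(6,10) by simp
  have "0 < s \<bullet> bt"
    using P s assms(7,8,14) by (simp add: inner_reg_response Dval_pos)
  then have "bt \<noteq> 0"
    by auto
  then have "0 < bt \<bullet> (matrix_inv P *v bt)"
    by (rule sym_pos_def_pos[OF sym_pos_def_inv[OF P]])
  with \<open>0 < s \<bullet> bt\<close> have "\<theta> > 0"
    using sym_pos_def_pos[OF P s] assms(9,15) by (simp add: add_pos_nonneg)
  moreover have "d \<bullet> bt = - \<theta> * (g \<bullet> s)"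
    using enhanced_dir_inner_reg_response[OF P s assms(7,8), of \<mu> g] assms(13-15)
    by (simp add: Cval_def)
  ultimately show ?thesis
    by simp
qed

end
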